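(* Let $(\mathcal{C},\varphi,\varphi')$ be an infinitesimal $*$-probability space and let $a,b\in\mathcal{C}$ be such that $(\mathcal{A}_a,\mathring{\mathcal{A}}_b)$ is infinitesimally monotone independent, where $\mathcal{A}_a$ is the (not necessarily unital) $*$-algebra generated by $a$ and $\mathring{\mathcal{A}}_b$ is the $*$-algebra generated by $b$ and $1$. Let $\alpha,\beta$ be non-zero complex numbers and let $p_{\alpha,\beta}=\alpha ab+\beta ba$. Then for every integer $k\geq 0$, $$\begin{aligned}\varphi'(p_{\alpha,\beta}^k)={}&\frac{\varphi(a^k)}{2^{k+1}\gamma}\Big[((\alpha+\beta)\varphi(b)+\gamma)^k\Big((\alpha+\beta)\big((k+1)\varphi'(b)-\varphi(b)\omega/\gamma^2\big)+k\omega/\gamma\Big)\\&\qquad-((\alpha+\beta)\varphi(b)-\gamma)^k\Big((\alpha+\beta)\big((k+1)\varphi'(b)-\varphi(b)\omega/\gamma^2\big)-k\omega/\gamma\Big)\Big]\\&+\frac{\varphi'(a^k)}{2^{k+1}\gamma}\Big[((\alpha+\beta)\varphi(b)+\gamma)^{k+1}-((\alpha+\beta)\varphi(b)-\gamma)^{k+1}\Big],\end{aligned}$$ where $$\gamma=\sqrt{(\alpha-\beta)^2\varphi(b)^2+4\alpha\beta\varphi(b^2)}\quad\text{and}\quad \omega=(\alpha-\beta)^2\varphi(b)\varphi'(b)+2\alpha\beta\,\varphi'(b^2).$$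
   Context: A $*$-probability space is a pair $(\mathcal{C},\varphi)$ where $\mathcal{C}$ is a unital complex $*$-algebra and $\varphi:\mathcal{C}\to\mathbb{C}$ is linear with $\varphi(1)=1$ and $\varphi(c^*c)\geq 0$ for all $c\in\mathcal{C}$. An infinitesimal $*$-probability space is a triple $(\mathcal{C},\varphi,\varphi')$ where $(\mathcal{C},\varphi)$ is a $*$-probability space and $\varphi':\mathcal{C}\to\mathbb{C}$ is a linear functional with $\varphi'(1)=0$ and $\varphi'(c^* )=\overline{\varphi'(c)}$ for all $c\in\mathcal{C}$. For $*$-subalgebras $\mathcal{A},\mathcal{B}$ of $\mathcal{C}$ (not necessarily unital), $(\mathcal{A},\mathcal{B})$ is infinitesimally monotone independent if $$\varphi(b_0a_1b_1\cdots a_nb_n)=\varphi(a_1\cdots a_n)\varphi(b_0)\varphi(b_1)\cdots\varphi(b_n)$$ and $$\varphi'(b_0a_1b_1\cdots a_nb_n)=\varphi'(a_1\cdots a_n)\varphi(b_0)\cdots\varphi(b_n)+\varphi(a_1\cdots a_n)\sum_{j=0}^n\varphi(b_0)\cdots\varphi(b_{j-1})\varphi'(b_j)\varphi(b_{j+1})\cdots\varphi(b_n)$$ for all $n\ge1$, $a_1,\dots,a_n\in\mathcal{A}$, $b_1,\dots,b_{n-1}\in\mathcal{B}$, and $b_0,b_n$ each either $1$ or an element of $\mathcal{B}$.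
   Formalization: The formula divides by γ and is undefined when γ = 0 (for example b = 0); it is proved as printed for γ ≠ 0 (either square root), and for γ = 0 the right-hand side is read as its limit as γ → 0 with ω and the other quantities fixed. *)

theory Defs
  imports "HOL-Analysis.Analysis"
begin

text \<open>
  The library has no type class of complex algebras with an involution, so the complex scalar
  multiplication and the involution on a ring with unit are locale parameters.
\<close>

locale complex_star_algebra = vector_space scaleC
  for scaleC :: "complex \<Rightarrow> 'c::ring_1 \<Rightarrow> 'c" +
  fixes star :: "'c \<Rightarrow> 'c"
  assumes scaleC_mult_left: "scaleC z x * y = scaleC z (x * y)"
    and scaleC_mult_right: "x * scaleC z y = scaleC z (x * y)"
    and star_star: "star (star x) = x"
    and star_add: "star (x + y) = star x + star y"
    and star_scaleC: "star (scaleC z x) = scaleC (cnj z) (star x)"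
    and star_mult: "star (x * y) = star y * star x"

locale star_probability_space = complex_star_algebra scaleC star
  for scaleC :: "complex \<Rightarrow> 'c::ring_1 \<Rightarrow> 'c" and star :: "'c \<Rightarrow> 'c" +
  fixes \<phi> :: "'c \<Rightarrow> complex"
  assumes phi_linear: "Vector_Spaces.linear scaleC (*) \<phi>"
    and phi_one: "\<phi> 1 = 1"
    and phi_nonneg: "\<phi> (star c * c) \<in> \<real>\<^sub>\<ge>\<^sub>0"

locale infinitesimal_star_probability_space = star_probability_space scaleC star \<phi>
  for scaleC :: "complex \<Rightarrow> 'c::ring_1 \<Rightarrow> 'c" and star :: "'c \<Rightarrow> 'c" and \<phi> :: "'c \<Rightarrow> complex" +
  fixes \<phi>' :: "'c \<Rightarrow> complex"
  assumes phi'_linear: "Vector_Spaces.linear scaleC (*) \<phi>'"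
    and phi'_one: "\<phi>' 1 = 0"
    and phi'_star: "\<phi>' (star c) = cnj (\<phi>' c)"

text \<open>Subalgebras are not required to contain the unit.\<close>

definition star_subalgebra ::
    "(complex \<Rightarrow> 'c::ring_1 \<Rightarrow> 'c) \<Rightarrow> ('c \<Rightarrow> 'c) \<Rightarrow> 'c set \<Rightarrow> bool" where
  "star_subalgebra scaleC star A \<longleftrightarrow>
     module.subspace scaleC A \<and> (\<forall>x\<in>A. \<forall>y\<in>A. x * y \<in> A) \<and> (\<forall>x\<in>A. star x \<in> A)"

definition generated_star_algebra ::
    "(complex \<Rightarrow> 'c::ring_1 \<Rightarrow> 'c) \<Rightarrow> ('c \<Rightarrow> 'c) \<Rightarrow> 'c set \<Rightarrow> 'c set" where
  "generated_star_algebra scaleC star S = star_subalgebra scaleC star hull S"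

text \<open>
  The word \<open>b\<^sub>0 a\<^sub>1 b\<^sub>1 \<dots> a\<^sub>n b\<^sub>n\<close> is given by two sequences \<open>a\<close> and \<open>b\<close>, of which only the
  entries \<open>a 1, \<dots>, a n\<close> and \<open>b 0, \<dots>, b n\<close> matter.
\<close>

definition infinitesimally_monotone_independent ::
    "('c::ring_1 \<Rightarrow> complex) \<Rightarrow> ('c \<Rightarrow> complex) \<Rightarrow> 'c set \<Rightarrow> 'c set \<Rightarrow> bool" where
  "infinitesimally_monotone_independent \<phi> \<phi>' A B \<longleftrightarrow>
     (\<forall>n a b. n \<ge> 1 \<longrightarrow> (\<forall>i\<in>{1..n}. a i \<in> A) \<longrightarrow> (\<forall>i\<in>{1..<n}. b i \<in> B) \<longrightarrow>
        b 0 \<in> insert 1 B \<longrightarrow> b n \<in> insert 1 B \<longrightarrow>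
        \<phi> (b 0 * prod_list (map (\<lambda>i. a i * b i) [1..<Suc n])) =
          \<phi> (prod_list (map a [1..<Suc n])) * (\<Prod>i\<le>n. \<phi> (b i)) \<and>
        \<phi>' (b 0 * prod_list (map (\<lambda>i. a i * b i) [1..<Suc n])) =
          \<phi>' (prod_list (map a [1..<Suc n])) * (\<Prod>i\<le>n. \<phi> (b i)) +
          \<phi> (prod_list (map a [1..<Suc n])) *
            (\<Sum>j\<le>n. (\<Prod>i<j. \<phi> (b i)) * \<phi>' (b j) * (\<Prod>i\<in>{j<..n}. \<phi> (b i))))"

text \<open>
  The right-hand side of the moment formula, as a function of \<open>g = \<gamma>\<close>. The arguments \<open>m\<close>, \<open>m'\<close>
  stand for \<open>\<phi>(b)\<close>, \<open>\<phi>'(b)\<close> and \<open>A\<close>, \<open>A'\<close> for \<open>\<phi>(a\<^sup>k)\<close>, \<open>\<phi>'(a\<^sup>k)\<close>. The expression divides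
  by \<open>g\<close>; its singularity at \<open>g = 0\<close> is removable, but since \<open>x / 0 = 0\<close> in HOL its value there is
  not the intended one, and one has to take the limit \<open>g \<rightarrow> 0\<close> with the other arguments fixed.
\<close>

definition infinitesimal_moment_formula ::
    "nat \<Rightarrow> complex \<Rightarrow> complex \<Rightarrow> complex \<Rightarrow> complex \<Rightarrow> complex \<Rightarrow> complex \<Rightarrow> complex \<Rightarrow> complex \<Rightarrow> complex"
  where
  "infinitesimal_moment_formula k \<alpha> \<beta> m m' A A' \<omega> g =
     A / (2 ^ (k + 1) * g) *
       (((\<alpha> + \<beta>) * m + g) ^ k *
          ((\<alpha> + \<beta>) * ((of_nat k + 1) * m' - m * \<omega> / g\<^sup>2) + of_nat k * \<omega> / g) -
        ((\<alpha> + \<beta>) * m - g) ^ k *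
          ((\<alpha> + \<beta>) * ((of_nat k + 1) * m' - m * \<omega> / g\<^sup>2) - of_nat k * \<omega> / g)) +
     A' / (2 ^ (k + 1) * g) *
       (((\<alpha> + \<beta>) * m + g) ^ (k + 1) - ((\<alpha> + \<beta>) * m - g) ^ (k + 1))"

end

theory Submission
  imports Defs
begin

text \<open>
  Multiplying a word \<open>b\<^sub>0 a b\<^sub>1 \<dots> a b\<^sub>n\<close> by \<open>p\<close> on the left gives a combination of two such words with
  \<open>n + 1\<close> letters \<open>a\<close>, beginning with \<open>1 a (b b\<^sub>0)\<close> and with \<open>b a b\<^sub>0\<close>. So \<open>\<phi>(p\<^sup>k)\<close> is \<open>\<phi>(a\<^sup>k)\<close> times
  the first entry \<open>u\<^sub>k\<close> of the vector \<open>(1, \<phi>(b))\<close> multiplied \<open>k\<close> times by a 2 by 2 matrix with trace \<open>s = (\<alpha> + \<beta>) \<phi>(b)\<close> and determinant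
  \<open>d = \<alpha>\<beta> (\<phi>(b)\<^sup>2 - \<phi>(b\<^sup>2))\<close>, and \<open>\<phi>'\<close> acts as a derivation:
  \<open>\<phi>'(p\<^sup>k) = \<phi>'(a\<^sup>k) u\<^sub>k + \<phi>(a\<^sup>k) u'\<^sub>k\<close>. The eigenvalues are \<open>(s \<plusminus> \<gamma>) / 2\<close>, and \<open>\<omega>\<close> is the derivative
  of \<open>\<gamma>\<^sup>2 / 2\<close>. As \<open>u\<^sub>k\<close> and \<open>u'\<^sub>k\<close> are polynomials in \<open>s, d, s', d'\<close>, the case \<open>\<gamma> = 0\<close> follows by continuity.
\<close>

section \<open>Lucas sequences, their derivatives and the moment formula\<close>

text \<open>The Lucas sequence of the first kind with index shifted by one, that is, the complete
  homogeneous symmetric polynomial of degree k in the roots of t^2 - s t + d. The recursion avoids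
  dividing by the difference of the roots, which vanishes for a double root.\<close>

fun lucas :: "complex \<Rightarrow> complex \<Rightarrow> nat \<Rightarrow> complex" where
  "lucas s d 0 = 1"
| "lucas s d (Suc 0) = s"
| "lucas s d (Suc (Suc k)) = s * lucas s d (Suc k) - d * lucas s d k"

text \<open>Directional derivative of \<open>lucas\<close> at (s, d) along (s', d'), obtained by
  applying the product rule to the recursion.\<close>

fun lucas_deriv :: "complex \<Rightarrow> complex \<Rightarrow> complex \<Rightarrow> complex \<Rightarrow> nat \<Rightarrow> complex" where
  "lucas_deriv s d s' d' 0 = 0"
| "lucas_deriv s d s' d' (Suc 0) = s'"
| "lucas_deriv s d s' d' (Suc (Suc k)) =
     s' * lucas s d (Suc k) + s * lucas_deriv s d s' d' (Suc k)
       - d' * lucas s d k - d * lucas_deriv s d s' d' k"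

lemma lucas_roots: "lucas (x + y) (x * y) k * (x - y) = x ^ (k + 1) - y ^ (k + 1)"
proof (induction k rule: induct_nat_012)
  case (ge2 n)
  have "lucas (x + y) (x * y) (Suc (Suc n)) * (x - y) =
      (x + y) * (lucas (x + y) (x * y) (Suc n) * (x - y)) - x * y * (lucas (x + y) (x * y) n * (x - y))"
    by (simp add: algebra_simps)
  also have "\<dots> = x ^ (Suc (Suc n) + 1) - y ^ (Suc (Suc n) + 1)"
    unfolding ge2 by (simp add: algebra_simps)
  finally show ?case .
qed (simp_all add: algebra_simps)

text \<open>The identity of \<open>lucas_roots\<close> differentiated and multiplied by \<open>x - y\<close>.\<close>

lemma lucas_deriv_roots:
  "lucas_deriv (x + y) (x * y) (x' + y') (x' * y + x * y') k * (x - y)\<^sup>2 =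
     (of_nat k + 1) * (x ^ k * x' - y ^ k * y') * (x - y) - (x ^ (k + 1) - y ^ (k + 1)) * (x' - y')"
proof (induction k rule: induct_nat_012)
  case (ge2 n)
  let ?U = "lucas (x + y) (x * y)" and ?V = "lucas_deriv (x + y) (x * y) (x' + y') (x' * y + x * y')"
  have "?V (Suc (Suc n)) * (x - y)\<^sup>2 =
      (x' + y') * (?U (Suc n) * (x - y)) * (x - y) + (x + y) * (?V (Suc n) * (x - y)\<^sup>2)
       - (x' * y + x * y') * (?U n * (x - y)) * (x - y) - x * y * (?V n * (x - y)\<^sup>2)"
    by (simp add: algebra_simps power2_eq_square)
  also have "\<dots> = (of_nat (Suc (Suc n)) + 1) * (x ^ Suc (Suc n) * x' - y ^ Suc (Suc n) * y') * (x - y)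
      - (x ^ (Suc (Suc n) + 1) - y ^ (Suc (Suc n) + 1)) * (x' - y')"
    unfolding ge2 lucas_roots by (simp add: algebra_simps)
  finally show ?case .
qed (simp_all add: algebra_simps power2_eq_square)

lemma isCont_lucas: "isCont (\<lambda>d. lucas s d k) d"
  by (induction s d k rule: lucas.induct) (auto intro!: continuous_intros)

lemma isCont_lucas_deriv: "isCont (\<lambda>d. lucas_deriv s d s' d' k) d"
  by (induction s d s' d' k rule: lucas_deriv.induct)
    (auto intro!: continuous_intros isCont_lucas)

lemma infinitesimal_moment_formula_eq_lucas:
  fixes \<alpha> \<beta> m m' A A' \<omega> g :: complex
  assumes "g \<noteq> 0"
  defines "s \<equiv> (\<alpha> + \<beta>) * m" and "s' \<equiv> (\<alpha> + \<beta>) * m'"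
  shows "infinitesimal_moment_formula k \<alpha> \<beta> m m' A A' \<omega> g =
    A * lucas_deriv s ((s\<^sup>2 - g\<^sup>2) / 4) s' ((s * s' - \<omega>) / 2) k +
    A' * lucas s ((s\<^sup>2 - g\<^sup>2) / 4) k"
proof -
  define x y where "x = (s + g) / 2" and "y = (s - g) / 2"
  \<comment> \<open>Since \<omega> stands for half the derivative of g^2, \<open>h\<close> stands
    for the derivative of g, and \<open>x'\<close>, \<open>y'\<close> for those of the
    roots.\<close>
  define h where "h = \<omega> / g"
  define x' y' where "x' = (s' + h) / 2" and "y' = (s' - h) / 2"
  have w: "\<omega> = g * h" using assms by (simp add: h_def)
  have sum: "x + y = s" "x' + y' = s'" "x - y = g" "x' - y' = h"
    by (simp_all add: x_def y_def x'_def y'_def field_simps)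
  have prod: "x * y = (s\<^sup>2 - g\<^sup>2) / 4" "x' * y + x * y' = (s * s' - \<omega>) / 2"
    by (simp_all add: x_def y_def x'_def y'_def w field_simps power2_eq_square)
  have U: "lucas s ((s\<^sup>2 - g\<^sup>2) / 4) k = (x ^ (k + 1) - y ^ (k + 1)) / g"
    using lucas_roots[of x y k] assms by (simp add: sum prod field_simps)
  have V: "lucas_deriv s ((s\<^sup>2 - g\<^sup>2) / 4) s' ((s * s' - \<omega>) / 2) k =
      ((of_nat k + 1) * (x ^ k * x' - y ^ k * y') * g - (x ^ (k + 1) - y ^ (k + 1)) * h) / g\<^sup>2"
    using lucas_deriv_roots[of x y x' y' k] assms by (simp add: sum prod field_simps)
  have pow: "(s + g) ^ n = 2 ^ n * x ^ n" "(s - g) ^ n = 2 ^ n * y ^ n" for n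
    by (simp_all add: x_def y_def power_divide)
  have T: "(\<alpha> + \<beta>) * ((of_nat k + 1) * m' - m * \<omega> / g\<^sup>2) = (of_nat k + 1) * s' - s * h / g"
    using assms by (simp add: w field_simps power2_eq_square)
  have kw: "of_nat k * \<omega> / g = of_nat k * h" using assms by (simp add: w)
  \<comment> \<open>The brackets of the formula, regrouped by roots; the factor 2 completes
    \<open>2 ^ k\<close> from \<open>pow\<close> to the \<open>2 ^ (k + 1)\<close> in the
    denominator.\<close>
  have xk: "(of_nat k + 1) * s' - s * h / g + of_nat k * h = 2 * ((of_nat k + 1) * x' - x * h / g)"
    "(of_nat k + 1) * s' - s * h / g - of_nat k * h = 2 * ((of_nat k + 1) * y' - y * h / g)"
    using assms by (simp_all add: x_def x'_def y_def y'_def field_simps)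
  show ?thesis
    unfolding infinitesimal_moment_formula_def U V s_def[symmetric] T kw xk pow
    using assms by (simp add: field_simps power2_eq_square)
qed

lemma infinitesimal_moment_formula_tendsto:
  fixes \<alpha> \<beta> m m' A A' \<omega> :: complex
  defines "s \<equiv> (\<alpha> + \<beta>) * m" and "s' \<equiv> (\<alpha> + \<beta>) * m'"
  shows "(infinitesimal_moment_formula k \<alpha> \<beta> m m' A A' \<omega> \<longlongrightarrow>
    A * lucas_deriv s (s\<^sup>2 / 4) s' ((s * s' - \<omega>) / 2) k + A' * lucas s (s\<^sup>2 / 4) k) (at 0)"
proof -
  let ?F = "\<lambda>g. A * lucas_deriv s ((s\<^sup>2 - g\<^sup>2) / 4) s' ((s * s' - \<omega>) / 2) k +
    A' * lucas s ((s\<^sup>2 - g\<^sup>2) / 4) k"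
  have "isCont ?F 0"
    by (intro continuous_intros isCont_o2[OF _ isCont_lucas] isCont_o2[OF _ isCont_lucas_deriv]) simp_all
  then have "?F \<midarrow>0\<rightarrow> ?F 0" by (simp add: isCont_def)
  \<comment> \<open>The filter \<open>at 0\<close> excludes 0 itself, so the value of the formula
    there, a division by zero, does not matter.\<close>
  moreover have "\<forall>\<^sub>F g in at 0. ?F g = infinitesimal_moment_formula k \<alpha> \<beta> m m' A A' \<omega> g"
    by (auto simp: eventually_at_filter infinitesimal_moment_formula_eq_lucas s_def s'_def)
  ultimately show ?thesis by (auto dest: Lim_transform_eventually)
qed

section \<open>Monotone independence for words with a repeated letter\<close>

primrec leibniz :: "('c \<Rightarrow> complex) \<Rightarrow> ('c \<Rightarrow> complex) \<Rightarrow> 'c list \<Rightarrow> complex" where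
  "leibniz f f' [] = 0"
| "leibniz f f' (x # xs) = f' x * prod_list (map f xs) + f x * leibniz f f' xs"

lemma prod_nth_eq_prod_list:
  "(\<Prod>i\<le>length xs. f ((x # xs) ! i)) = (f x :: complex) * prod_list (map f xs)"
proof (induction xs arbitrary: x)
  case (Cons y ys)
  show ?case
    using Cons[of y] by (simp add: prod.atMost_Suc_shift del: prod.atMost_Suc)
qed simp

lemma prod_shift_greaterThanAtMost:
  "(\<Prod>i\<in>{Suc j<..Suc n}. f i) = (\<Prod>i\<in>{j<..n}. f (Suc i) :: complex)"
  by (simp add: prod.atLeast_Suc_atMost_Suc_shift del: prod.cl_ivl_Suc
      flip: atLeastSucAtMost_greaterThanAtMost)

text \<open>Splitting off the term j = 0 leaves \<open>f x\<close> times the same sum for the tail.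
  The list is nonempty because it holds the n + 1 entries of index 0 to n.\<close>

lemma sum_eq_leibniz:
  "(\<Sum>j\<le>length xs. (\<Prod>i<j. f ((x # xs) ! i)) * f' ((x # xs) ! j) *
      (\<Prod>i\<in>{j<..length xs}. f ((x # xs) ! i))) = leibniz f f' (x # xs)"
proof (induction xs arbitrary: x)
  case (Cons y ys)
  have *: "(\<Prod>i\<in>{0<..Suc (length ys)}. f ((x # y # ys) ! i)) = f y * prod_list (map f ys)"
    using prod_nth_eq_prod_list[of f y ys]
    by (simp add: prod.atLeast_Suc_atMost_Suc_shift atLeast0AtMost del: prod.cl_ivl_Suc
        flip: atLeastSucAtMost_greaterThanAtMost)
  show ?case
    using Cons[of y]
    by (simp add: sum.atMost_Suc_shift prod.lessThan_Suc_shift prod_shift_greaterThanAtMost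
        mult.assoc sum_distrib_left[symmetric] * del: sum.atMost_Suc prod.lessThan_Suc nth_Cons_pos)
qed simp

definition interleave :: "'c::ring_1 \<Rightarrow> 'c \<Rightarrow> 'c list \<Rightarrow> 'c" where
  "interleave a x xs = x * prod_list (map ((*) a) xs)"

lemma interleave_Cons: "x * a * interleave a y ys = interleave a x (y # ys)"
  by (simp add: interleave_def mult.assoc)

lemma mult_interleave: "z * interleave a x xs = interleave a (z * x) xs"
  by (simp add: interleave_def mult.assoc)

text \<open>Independence speaks only of n at least 1. The empty list is the case n = 0, where the
  formula follows from the values of the functionals at 1.\<close>

lemma infinitesimally_monotone_independent_interleave:
  assumes ind: "infinitesimally_monotone_independent \<phi> \<phi>' A B"
    and one: "\<phi> 1 = 1" "\<phi>' 1 = 0"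
    and a: "a \<in> A" and x: "x \<in> B" "set xs \<subseteq> B"
  shows "\<phi>' (interleave a x xs) =
    \<phi>' (a ^ length xs) * (\<phi> x * prod_list (map \<phi> xs)) + \<phi> (a ^ length xs) * leibniz \<phi> \<phi>' (x # xs)"
proof (cases "xs = []")
  case True
  then show ?thesis by (simp add: interleave_def one)
next
  case False
  let ?b = "\<lambda>i. (x # xs) ! i" and ?n = "length xs"
  have B: "?b i \<in> B" if "i \<le> ?n" for i
    using that x nth_mem[of i "x # xs"] by auto
  have tl: "xs ! (i - Suc 0) \<in> B" if "i < ?n" for i
    using that x(2) nth_mem[of "i - Suc 0" xs] by auto
  have n: "?n \<ge> 1" using False by (cases xs) auto
  have w: "map (\<lambda>i. a * ?b i) [1..<Suc ?n] = map ((*) a) xs"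
    by (rule nth_equalityI) (auto simp del: upt_Suc)
  have c: "map (\<lambda>i. a) [1..<Suc ?n] = replicate ?n a"
    by (simp add: map_replicate_const del: upt_Suc)
  from ind[unfolded infinitesimally_monotone_independent_def, rule_format, of ?n "\<lambda>_. a" ?b] n a B tl x(1)
  show ?thesis
    unfolding w c prod_nth_eq_prod_list sum_eq_leibniz by (simp add: interleave_def)
qed

section \<open>Left multiplication by \<open>p\<close> as a transfer recursion\<close>

primrec transfer :: "('c::ring_1 \<Rightarrow> complex) \<Rightarrow> complex \<Rightarrow> complex \<Rightarrow> 'c \<Rightarrow> nat \<Rightarrow> 'c \<Rightarrow> complex" where
  "transfer \<phi> \<alpha> \<beta> b 0 x = \<phi> x"
| "transfer \<phi> \<alpha> \<beta> b (Suc j) x =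
     \<alpha> * transfer \<phi> \<alpha> \<beta> b j 1 * \<phi> (b * x) + \<beta> * transfer \<phi> \<alpha> \<beta> b j b * \<phi> x"

primrec transfer_deriv ::
    "('c::ring_1 \<Rightarrow> complex) \<Rightarrow> ('c \<Rightarrow> complex) \<Rightarrow> complex \<Rightarrow> complex \<Rightarrow> 'c \<Rightarrow> nat \<Rightarrow> 'c \<Rightarrow> complex" where
  "transfer_deriv \<phi> \<phi>' \<alpha> \<beta> b 0 x = \<phi>' x"
| "transfer_deriv \<phi> \<phi>' \<alpha> \<beta> b (Suc j) x =
     \<alpha> * (transfer_deriv \<phi> \<phi>' \<alpha> \<beta> b j 1 * \<phi> (b * x) + transfer \<phi> \<alpha> \<beta> b j 1 * \<phi>' (b * x)) +
     \<beta> * (transfer_deriv \<phi> \<phi>' \<alpha> \<beta> b j b * \<phi> x + transfer \<phi> \<alpha> \<beta> b j b * \<phi>' x)"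

text \<open>Cayley-Hamilton: the values at 1 and \<open>b\<close> evolve by the matrix with rows
  (\<alpha> \<phi>(b), \<beta>) and (\<alpha> \<phi>(b^2), \<beta> \<phi>(b)), whose trace and
  determinant are the parameters of \<open>lucas\<close>.\<close>

lemma transfer_eq_lucas:
  assumes "\<phi> 1 = 1"
  shows "transfer \<phi> \<alpha> \<beta> b k 1 =
    lucas ((\<alpha> + \<beta>) * \<phi> b) (\<alpha> * \<beta> * ((\<phi> b)\<^sup>2 - \<phi> (b\<^sup>2))) k"
proof (induction k rule: induct_nat_012)
  case (ge2 n)
  show ?case
    unfolding lucas.simps ge2[symmetric] by (simp add: assms algebra_simps power2_eq_square)
qed (simp_all add: assms algebra_simps)

text \<open>The previous identity differentiated along \<phi>'; the last two parameters are the
  derivatives of trace and determinant.\<close>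

lemma transfer_deriv_eq_lucas_deriv:
  assumes "\<phi> 1 = 1" "\<phi>' 1 = 0"
  shows "transfer_deriv \<phi> \<phi>' \<alpha> \<beta> b k 1 =
    lucas_deriv ((\<alpha> + \<beta>) * \<phi> b) (\<alpha> * \<beta> * ((\<phi> b)\<^sup>2 - \<phi> (b\<^sup>2)))
      ((\<alpha> + \<beta>) * \<phi>' b) (\<alpha> * \<beta> * (2 * \<phi> b * \<phi>' b - \<phi>' (b\<^sup>2))) k"
proof (induction k rule: induct_nat_012)
  case (ge2 n)
  show ?case
    unfolding lucas_deriv.simps ge2[symmetric] transfer_eq_lucas[where \<phi> = \<phi>, OF assms(1), symmetric]
    by (simp add: assms algebra_simps power2_eq_square)
qed (simp_all add: assms algebra_simps)

context complex_star_algebra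
begin

lemma generated_star_algebra_superset: "S \<subseteq> generated_star_algebra scaleC star S"
  unfolding generated_star_algebra_def by (rule hull_subset)

lemma generated_star_algebra_mult:
  "x \<in> generated_star_algebra scaleC star S \<Longrightarrow> y \<in> generated_star_algebra scaleC star S \<Longrightarrow>
    x * y \<in> generated_star_algebra scaleC star S"
  unfolding generated_star_algebra_def hull_def star_subalgebra_def by blast

end

context infinitesimal_star_probability_space
begin

lemma phi'_add: "\<phi>' (x + y) = \<phi>' x + \<phi>' y"
  and phi'_scaleC: "\<phi>' (scaleC z x) = z * \<phi>' x"
proof -
  interpret Vector_Spaces.linear scaleC "(*)" \<phi>' by (rule phi'_linear)
  show "\<phi>' (x + y) = \<phi>' x + \<phi>' y" "\<phi>' (scaleC z x) = z * \<phi>' x"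
    by (rule add scale)+
qed

lemma phi'_power_mult_interleave:
  assumes ind: "infinitesimally_monotone_independent \<phi> \<phi>' A B"
    and a: "a \<in> A" and B: "1 \<in> B" "b \<in> B" "\<And>x y. x \<in> B \<Longrightarrow> y \<in> B \<Longrightarrow> x * y \<in> B"
    and p: "p = scaleC \<alpha> (a * b) + scaleC \<beta> (b * a)"
  shows "x \<in> B \<Longrightarrow> set xs \<subseteq> B \<Longrightarrow>
    \<phi>' (p ^ j * interleave a x xs) =
      \<phi>' (a ^ (j + length xs)) * (transfer \<phi> \<alpha> \<beta> b j x * prod_list (map \<phi> xs)) +
      \<phi> (a ^ (j + length xs)) * (transfer_deriv \<phi> \<phi>' \<alpha> \<beta> b j x * prod_list (map \<phi> xs) +
        transfer \<phi> \<alpha> \<beta> b j x * leibniz \<phi> \<phi>' xs)"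
proof (induction j arbitrary: x xs)
  case 0
  then show ?case
    using infinitesimally_monotone_independent_interleave[OF ind phi_one phi'_one a] by simp
next
  case (Suc j)
  \<comment> \<open>The rightmost factor of the power acts first: it pushes the leading letter into
    the tail, as \<open>b * x\<close> behind a new leading 1 or as \<open>x\<close> behind a new
    leading \<open>b\<close>. Hence the induction must allow every \<open>x\<close> and
    \<open>xs\<close>.\<close>
  have "p * interleave a x xs =
      scaleC \<alpha> (1 * a * interleave a (b * x) xs) + scaleC \<beta> (b * a * interleave a x xs)"
    by (simp add: p distrib_right scaleC_mult_left mult.assoc flip: mult_interleave)
  then have "p ^ Suc j * interleave a x xs =
      scaleC \<alpha> (p ^ j * interleave a 1 (b * x # xs)) + scaleC \<beta> (p ^ j * interleave a b (x # xs))"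
    unfolding interleave_Cons
    by (simp add: power_Suc2 mult.assoc distrib_left scaleC_mult_right del: power_Suc)
  then show ?case
    using Suc.IH[of 1 "b * x # xs"] Suc.IH[of b "x # xs"] Suc.prems B
    by (simp add: phi'_add phi'_scaleC algebra_simps del: power_Suc)
qed

end

theorem theorem4p2:
  fixes scaleC :: "complex \<Rightarrow> 'c::ring_1 \<Rightarrow> 'c" and star :: "'c \<Rightarrow> 'c"
    and \<phi> \<phi>' :: "'c \<Rightarrow> complex"
    and a b p :: 'c and \<alpha> \<beta> \<gamma> \<omega> :: complex and k :: nat
  assumes "infinitesimal_star_probability_space scaleC star \<phi> \<phi>'"
    and "infinitesimally_monotone_independent \<phi> \<phi>'
           (generated_star_algebra scaleC star {a}) (generated_star_algebra scaleC star {b, 1})"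
    and "\<alpha> \<noteq> 0" and "\<beta> \<noteq> 0"
    and "p = scaleC \<alpha> (a * b) + scaleC \<beta> (b * a)"
    and "\<gamma>\<^sup>2 = (\<alpha> - \<beta>)\<^sup>2 * (\<phi> b)\<^sup>2 + 4 * \<alpha> * \<beta> * \<phi> (b\<^sup>2)"
    and "\<omega> = (\<alpha> - \<beta>)\<^sup>2 * \<phi> b * \<phi>' b + 2 * \<alpha> * \<beta> * \<phi>' (b\<^sup>2)"
  shows "(\<gamma> \<noteq> 0 \<longrightarrow>
            \<phi>' (p ^ k) = infinitesimal_moment_formula k \<alpha> \<beta> (\<phi> b) (\<phi>' b) (\<phi> (a ^ k)) (\<phi>' (a ^ k)) \<omega> \<gamma>) \<and>
         (\<gamma> = 0 \<longrightarrow>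
            (infinitesimal_moment_formula k \<alpha> \<beta> (\<phi> b) (\<phi>' b) (\<phi> (a ^ k)) (\<phi>' (a ^ k)) \<omega>
              \<longlongrightarrow> \<phi>' (p ^ k)) (at 0))"
proof -
  interpret infinitesimal_star_probability_space scaleC star \<phi> \<phi>' by fact
  let ?A = "generated_star_algebra scaleC star {a}" and ?B = "generated_star_algebra scaleC star {b, 1}"
  define s s' where "s = (\<alpha> + \<beta>) * \<phi> b" and "s' = (\<alpha> + \<beta>) * \<phi>' b"
  have mem: "a \<in> ?A" "1 \<in> ?B" "b \<in> ?B"
    using generated_star_algebra_superset[of "{a}"] generated_star_algebra_superset[of "{b, 1}"]
    by auto
  \<comment> \<open>The determinant and its derivative in terms of \<gamma> and \<omega>; both
    identities also hold when \<gamma> = 0.\<close>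
  have d: "\<alpha> * \<beta> * ((\<phi> b)\<^sup>2 - \<phi> (b\<^sup>2)) = (s\<^sup>2 - \<gamma>\<^sup>2) / 4"
    unfolding assms(6) s_def by (simp add: field_simps power2_eq_square)
  have d': "\<alpha> * \<beta> * (2 * \<phi> b * \<phi>' b - \<phi>' (b\<^sup>2)) = (s * s' - \<omega>) / 2"
    unfolding assms(7) s_def s'_def by (simp add: field_simps power2_eq_square)
  have "\<phi>' (p ^ k) = \<phi>' (p ^ k * interleave a 1 [])"
    by (simp add: interleave_def)
  also have "\<dots> = \<phi> (a ^ k) * transfer_deriv \<phi> \<phi>' \<alpha> \<beta> b k 1 + \<phi>' (a ^ k) * transfer \<phi> \<alpha> \<beta> b k 1"
    using phi'_power_mult_interleave[OF assms(2) mem generated_star_algebra_mult assms(5), of 1 "[]" k] mem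
    by simp
  also have "\<dots> = \<phi> (a ^ k) * lucas_deriv s ((s\<^sup>2 - \<gamma>\<^sup>2) / 4) s' ((s * s' - \<omega>) / 2) k +
      \<phi>' (a ^ k) * lucas s ((s\<^sup>2 - \<gamma>\<^sup>2) / 4) k"
    by (simp add: transfer_deriv_eq_lucas_deriv[of \<phi> \<phi>', OF phi_one phi'_one]
        transfer_eq_lucas[of \<phi>, OF phi_one] flip: d d' s_def s'_def)
  finally have *: "\<phi>' (p ^ k) = \<dots>" .
  show ?thesis
    unfolding * using infinitesimal_moment_formula_eq_lucas infinitesimal_moment_formula_tendsto
    by (simp add: s_def s'_def)
qed

end
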